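(* Let $p,M,\ell\ge 1$ be integers, $N=\ell M$ and $n=Np$. Let $\{\{F_j^{(k)}\}_{j=0}^{M-1}\}_{k=1}^{\ell}$ be a family of matrices in $\mathbb{S}^+$ (upper triangular $p\times p$ complex matrices with positive diagonal entries) satisfying $$F_0^{(1)}\ge F_1^{(1)}\ge\cdots\ge F_{M-1}^{(1)}>F_0^{(2)}\ge\cdots\ge F_{M-1}^{(\ell-1)}>F_0^{(\ell)}\ge\cdots\ge F_{M-1}^{(\ell)}>0,$$ that is, non-increasing within each cycle and strictly decreasing at each transition $F_{M-1}^{(k)}>F_0^{(k+1)}$ between cycles. Then there exist a matrix $A\in\mathbb{C}^{n\times n}$ and a block right-hand side $\mathbf{B}\in\mathbb{C}^{n\times p}$ such that restarted block GMRES with cycle length $M$ and zero initial guess, applied to $A\mathbf{X}=\mathbf{B}$, yields residuals satisfying $\|\mathbf{R}_j^{(k)}\|_{\mathbb S}=F_j^{(k)}$ for all $j=0,1,\ldots,M-1$ and $k=1,\ldots,\ell$.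
   Context: Order: for upper triangular $p\times p$ matrices $R_1,R_2$ with non-negative diagonal, $R_1\le R_2$ means that $R_2^*R_2-R_1^*R_1$ is Hermitian positive semidefinite, and $R_1<R_2$ means that it is positive definite. Block norm: for $\mathbf{Z}\in\mathbb{C}^{n\times p}$ of full column rank, $\|\mathbf{Z}\|_{\mathbb S}$ is the unique upper triangular $R\in\mathbb{C}^{p\times p}$ with positive diagonal such that $\mathbf{Z}=\mathbf{Q}R$ with $\mathbf{Q}^*\mathbf{Q}=I_p$; equivalently $R^*R=\mathbf{Z}^*\mathbf{Z}$. Block Krylov subspace: $\mathbb{K}_j(A,\mathbf{R})=\{\sum_{i=0}^{j-1}A^i\mathbf{R}S_i : S_i\in\mathbb{C}^{p\times p}\}\subset\mathbb{C}^{n\times p}$. Restarted block GMRES with cycle length $M$: set $\mathbf{X}_0^{(1)}=0$ and $\mathbf{R}_0^{(1)}=\mathbf{B}$. In cycle $k$, for $j=0,1,\ldots,M$, the iterate $\mathbf{X}_j^{(k)}\in\mathbf{X}_0^{(k)}+\mathbb{K}_j(A,\mathbf{R}_0^{(k)})$ minimizes the Frobenius norm of $\mathbf{R}_j^{(k)}=\mathbf{B}-A\mathbf{X}_j^{(k)}$. The next cycle starts with $\mathbf{X}_0^{(k+1)}=\mathbf{X}_M^{(k)}$ and $\mathbf{R}_0^{(k+1)}=\mathbf{R}_M^{(k)}$. *)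

theory Defs
  imports
    "Jordan_Normal_Form.Schur_Decomposition"
    "Jordan_Normal_Form.DL_Rank"
begin

text \<open>
  All matrices are complex matrices with explicit carriers. The order on complex numbers used below
  is the one of \<open>Complex_Order\<close>: \<open>0 < z\<close> says that \<open>z\<close> is a positive real number.
\<close>

definition S_plus :: "nat \<Rightarrow> complex mat set" where
  "S_plus p = {R \<in> carrier_mat p p. upper_triangular R \<and> (\<forall>i<p. 0 < R $$ (i, i))}"

definition hermitian_mat :: "complex mat \<Rightarrow> bool" where
  "hermitian_mat H \<longleftrightarrow> square_mat H \<and> mat_adjoint H = H"

definition pos_semidef_mat :: "complex mat \<Rightarrow> bool" where
  "pos_semidef_mat H \<longleftrightarrow>
     hermitian_mat H \<and> (\<forall>v \<in> carrier_vec (dim_col H). 0 \<le> (H *\<^sub>v v) \<bullet>c v)"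

definition pos_def_mat :: "complex mat \<Rightarrow> bool" where
  "pos_def_mat H \<longleftrightarrow>
     hermitian_mat H \<and>
     (\<forall>v \<in> carrier_vec (dim_col H). v \<noteq> 0\<^sub>v (dim_col H) \<longrightarrow> 0 < (H *\<^sub>v v) \<bullet>c v)"

text \<open>
  The two relations are meant for upper triangular matrices of equal size with non-negative
  diagonal; this is not part of the definitions. Note that \<open>tri_less\<close> is not the strict part
  of \<open>tri_le\<close>.
\<close>

definition tri_le :: "complex mat \<Rightarrow> complex mat \<Rightarrow> bool" (infix "\<le>\<^sub>S" 50) where
  "R1 \<le>\<^sub>S R2 \<longleftrightarrow> pos_semidef_mat (mat_adjoint R2 * R2 - mat_adjoint R1 * R1)"

definition tri_less :: "complex mat \<Rightarrow> complex mat \<Rightarrow> bool" (infix "<\<^sub>S" 50) where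
  "R1 <\<^sub>S R2 \<longleftrightarrow> pos_def_mat (mat_adjoint R2 * R2 - mat_adjoint R1 * R1)"

definition full_column_rank :: "complex mat \<Rightarrow> bool" where
  "full_column_rank Z \<longleftrightarrow> vec_space.rank (dim_row Z) Z = dim_col Z"

text \<open>Only meaningful for \<open>Z\<close> of full column rank; otherwise no such \<open>R\<close> exists.\<close>

definition block_norm :: "complex mat \<Rightarrow> complex mat" where
  "block_norm Z = (THE R. R \<in> S_plus (dim_col Z) \<and>
     (\<exists>Q \<in> carrier_mat (dim_row Z) (dim_col Z).
        mat_adjoint Q * Q = 1\<^sub>m (dim_col Z) \<and> Z = Q * R))"

definition frobenius_norm :: "complex mat \<Rightarrow> real" where
  "frobenius_norm Z = sqrt (\<Sum>r<dim_row Z. \<Sum>c<dim_col Z. (cmod (Z $$ (r, c)))\<^sup>2)"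

text \<open>The sum over \<open>i\<close> of the matrices \<open>A ^\<^sub>m i * R * S i\<close> is written entrywise.\<close>

definition block_krylov :: "nat \<Rightarrow> complex mat \<Rightarrow> complex mat \<Rightarrow> complex mat set" where
  "block_krylov j A R =
     {mat (dim_row R) (dim_col R) (\<lambda>(r, c). \<Sum>i<j. (A ^\<^sub>m i * R * S i) $$ (r, c)) | S.
        \<forall>i<j. S i \<in> carrier_mat (dim_col R) (dim_col R)}"

definition residual :: "complex mat \<Rightarrow> complex mat \<Rightarrow> complex mat \<Rightarrow> complex mat" where
  "residual A B X = B - A * X"

definition gmres_iterate ::
  "complex mat \<Rightarrow> complex mat \<Rightarrow> complex mat \<Rightarrow> nat \<Rightarrow> complex mat \<Rightarrow> bool" where
  "gmres_iterate A B X0 j X \<longleftrightarrow>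
     (let \<X> = {X0 + Y | Y. Y \<in> block_krylov j A (residual A B X0)}
      in X \<in> \<X> \<and>
         (\<forall>X' \<in> \<X>. frobenius_norm (residual A B X) \<le> frobenius_norm (residual A B X')))"

text \<open>
  \<open>restarted_gmres A B M l X\<close> says that \<open>X k j\<close>, for \<open>1 \<le> k \<le> l\<close> and \<open>0 \<le> j \<le> M\<close>, are iterates of the
  first \<open>l\<close> cycles of restarted block GMRES with cycle length \<open>M\<close> and zero initial guess. It is a
  relation because for singular \<open>A\<close> the minimizers need not be unique.
\<close>

definition restarted_gmres ::
  "complex mat \<Rightarrow> complex mat \<Rightarrow> nat \<Rightarrow> nat \<Rightarrow> (nat \<Rightarrow> nat \<Rightarrow> complex mat) \<Rightarrow> bool" where
  "restarted_gmres A B M l X \<longleftrightarrow>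
     X 1 0 = 0\<^sub>m (dim_row B) (dim_col B) \<and>
     (\<forall>k \<in> {1..l}. \<forall>j \<le> M. gmres_iterate A B (X k 0) j (X k j)) \<and>
     (\<forall>k \<in> {1..<l}. X (Suc k) 0 = X k M)"

end

theory Submission
  imports Defs
begin

text \<open>
  Write \<open>\<Phi>\<^sub>b\<close> for the prescribed norms in a single index \<open>b = (k - 1) M + j < N\<close>, and \<open>\<Phi>\<^sub>N = 0\<close>.
  Factor \<open>\<Phi>\<^sub>b\<^sup>* \<Phi>\<^sub>b - \<Phi>\<^sub>b\<^sub>+\<^sub>1\<^sup>* \<Phi>\<^sub>b\<^sub>+\<^sub>1 = G\<^sub>b\<^sup>* G\<^sub>b\<close> and, with the block unit vectors \<open>E\<^sub>b\<close>, put
  \<open>H\<^sub>m = \<Sum>b\<ge>m. E\<^sub>b G\<^sub>b\<close>, so that \<open>H\<^sub>m\<^sup>* H\<^sub>m = \<Phi>\<^sub>m\<^sup>* \<Phi>\<^sub>m\<close> by telescoping. It suffices that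
  \<open>H\<^sub>m\<close> is the residual with index \<open>m\<close>, which holds for the right-hand side \<open>H\<^sub>0\<close> as soon as
  \<open>A E\<^sub>b = E\<^sub>b\<^sub>+\<^sub>1\<close> within a cycle and \<open>A H\<^sub>a = E\<^sub>a\<close> whenever \<open>a\<close> is a multiple of \<open>M\<close>: then \<open>j\<close> steps
  from \<open>H\<^sub>a\<close> can remove precisely the blocks \<open>a, \<dots>, a + j - 1\<close>. The second condition fixes
  \<open>A E\<^sub>b G\<^sub>b\<close> for the last block \<open>b\<close> of each cycle, and can be met because \<open>G\<^sub>b\<close> is invertible there
  by the strict decrease between cycles.
\<close>

section \<open>Gram factorization of positive semidefinite matrices\<close>

text \<open>This is v^H f v. A function of two indices stands for the matrix, so that elimination
  involves no carriers.\<close>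

definition qform :: "nat \<Rightarrow> (nat \<Rightarrow> nat \<Rightarrow> complex) \<Rightarrow> (nat \<Rightarrow> complex) \<Rightarrow> complex" where
  "qform p f v = (\<Sum>i<p. \<Sum>j<p. f i j * v j * cnj (v i))"

definition hermitian_fun :: "nat \<Rightarrow> (nat \<Rightarrow> nat \<Rightarrow> complex) \<Rightarrow> bool" where
  "hermitian_fun p f \<longleftrightarrow> (\<forall>i<p. \<forall>j<p. f j i = cnj (f i j))"

lemma hermitian_funD: "hermitian_fun p f \<Longrightarrow> i < p \<Longrightarrow> j < p \<Longrightarrow> f j i = cnj (f i j)"
  unfolding hermitian_fun_def by blast

text \<open>Along one coordinate the form is quadratic in \<open>t\<close>. A zero pivot
  \<open>f k k\<close> leaves it affine, a nonzero one allows completing the square; the next two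
  lemmas treat these cases.\<close>

lemma qform_shift:
  assumes herm: "hermitian_fun p f" and k: "k < p"
  defines "s \<equiv> \<lambda>v. \<Sum>j<p. f k j * v j"
  shows "qform p f (\<lambda>i. v i + (if i = k then t else 0))
       = qform p f v + cnj t * s v + t * cnj (s v) + t * cnj t * f k k"
proof -
  have s': "cnj (s v) = (\<Sum>i<p. f i k * cnj (v i))"
    unfolding s_def cnj_sum by (intro sum.cong) (auto simp: hermitian_funD[OF herm k] mult.commute)
  have d: "(\<Sum>j<p. h j * (if j = k then c else 0)) = h k * c" for h and c :: complex
    using k by (simp add: if_distrib[of "\<lambda>x. _ * x"] sum.delta cong: if_cong)
  have "qform p f (\<lambda>i. v i + (if i = k then t else 0)) =
     (\<Sum>i<p. (\<Sum>j<p. f i j * (v j + (if j = k then t else 0))) * (cnj (v i) + (if i = k then cnj t else 0)))"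
    unfolding qform_def sum_distrib_right by (intro sum.cong refl) auto
  also have "\<dots> = (\<Sum>i<p. ((\<Sum>j<p. f i j * v j) + f i k * t) * (cnj (v i) + (if i = k then cnj t else 0)))"
    by (simp add: distrib_left sum.distrib d)
  also have "\<dots> = (\<Sum>i<p. ((\<Sum>j<p. f i j * v j) + f i k * t) * cnj (v i)) + (s v + f k k * t) * cnj t"
    unfolding s_def by (simp only: distrib_left sum.distrib d)
  also have "(\<Sum>i<p. ((\<Sum>j<p. f i j * v j) + f i k * t) * cnj (v i)) = qform p f v + cnj (s v) * t"
    unfolding s' qform_def sum_distrib_right sum.distrib[symmetric]
    by (intro sum.cong refl) (simp add: distrib_right distrib_left sum_distrib_left mult_ac)
  also have "\<dots> + (s v + f k k * t) * cnj t = qform p f v + cnj t * s v + t * cnj (s v) + t * cnj t * f k k"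
    by (simp add: algebra_simps)
  finally show ?thesis .
qed

text \<open>With a zero pivot the form is affine along coordinate \<open>k\<close>, so moving far
  against a nonzero slope would make it negative.\<close>

lemma psd_zero_diagonal_imp_zero_row:
  assumes herm: "hermitian_fun p f"
    and psd: "\<And>v. 0 \<le> qform p f v" and k: "k < p" and z: "f k k = 0" and i: "i < p"
  shows "f k i = 0"
proof (rule ccontr)
  assume nz: "f k i \<noteq> 0"
  define s where "s = f k i"
  define e where "e = (\<lambda>j. if j = i then 1 else 0 :: complex)"
  have sv: "(\<Sum>j<p. f k j * e j) = s"
    using i by (simp add: e_def s_def if_distrib[of "\<lambda>x. _ * x"] sum.delta cong: if_cong)
  have ineq: "0 \<le> Re (qform p f e) - 2 * \<tau> * (cmod s)\<^sup>2" for \<tau> :: real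
  proof -
    let ?t = "- of_real \<tau> * s"
    have "0 \<le> qform p f (\<lambda>j. e j + (if j = k then ?t else 0))" by (rule psd)
    also have "\<dots> = qform p f e + cnj ?t * s + ?t * cnj s"
      using qform_shift[OF herm k, where v = e and t = ?t] unfolding sv z by simp
    also have "\<dots> = qform p f e - 2 * of_real \<tau> * (s * cnj s)"
      by simp
    also have "s * cnj s = of_real ((cmod s)\<^sup>2)"
      by (simp only: complex_norm_square)
    finally show ?thesis by (simp add: less_eq_complex_def)
  qed
  have "cmod s > 0" using nz s_def by simp
  then show False
    \<comment> \<open>This value of \<open>\<tau>\<close> turns the lower bound into 0 \<le>
      -1.\<close>
    using ineq[of "(Re (qform p f e) + 1) / (2 * (cmod s)\<^sup>2)"] by (simp add: field_simps)
qed

text \<open>Completing the square: the value at \<open>v\<close> is that of the original form after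
  coordinate \<open>k\<close> is shifted by \<open>- s / f k k\<close>.\<close>

lemma psd_schur_complement:
  assumes herm: "hermitian_fun p f"
    and psd: "\<And>v. 0 \<le> qform p f v" and k: "k < p" and nz: "f k k \<noteq> 0"
  shows "0 \<le> qform p (\<lambda>i j. f i j - f i k * f k j / f k k) v"
proof -
  define s where "s = (\<Sum>j<p. f k j * v j)"
  have cs: "cnj s = (\<Sum>i<p. f i k * cnj (v i))"
    unfolding s_def cnj_sum by (intro sum.cong) (auto simp: hermitian_funD[OF herm k] mult.commute)
  have real: "cnj (f k k) = f k k" by (rule hermitian_funD[OF herm k k, symmetric])
  have "qform p (\<lambda>i j. f i j - f i k * f k j / f k k) v =
      qform p f v - (\<Sum>i<p. f i k * cnj (v i)) * (\<Sum>j<p. f k j * v j) / f k k"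
    unfolding qform_def sum_product sum_divide_distrib sum_subtractf[symmetric]
    by (intro sum.cong refl) (simp add: algebra_simps)
  also have "\<dots> = qform p f (\<lambda>i. v i + (if i = k then - s / f k k else 0))"
    using qform_shift[OF herm k, where v = v and t = "- s / f k k", folded s_def] nz
    unfolding cs[symmetric] s_def[symmetric] by (simp add: real)
  finally show ?thesis using psd by simp
qed

text \<open>
  Symmetric Gaussian elimination, clearing one row and column after the other; the size of the
  matrix is kept and \<open>k\<close> counts the rows already cleared.
\<close>

lemma psd_gram_aux:
  assumes "k \<le> p"
    and "hermitian_fun p f"
    and "\<And>v. 0 \<le> qform p f v"
    and "\<And>i j. i < k \<Longrightarrow> j < p \<Longrightarrow> f i j = 0"
  shows "\<exists>g. (\<forall>i<p. \<forall>j<p. f i j = (\<Sum>t<p. cnj (g t i) * g t j)) \<and> (\<forall>t<k. \<forall>i. g t i = (0::complex))"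
  using assms
\<comment> \<open>The induction descends from \<open>k = p\<close>, where all of \<open>f\<close>
  vanishes. The clause on zero rows of \<open>g\<close>, taken at \<open>Suc k\<close>, leaves row
  \<open>k\<close> of the factor free for the current pivot.\<close>
proof (induction k arbitrary: f rule: inc_induct)
  case base
  then show ?case by (intro exI[of _ "\<lambda>_ _. 0"]) auto
next
  case (step k)
  note herm = step.prems(1) and psd = step.prems(2) and zero = step.prems(3)
  have k: "k < p" using step.hyps by simp
  show ?case
  proof (cases "f k k = 0")
    case True
    have "f i j = 0" if "i < Suc k" "j < p" for i j
    proof (cases "i = k")
      case True
      with psd_zero_diagonal_imp_zero_row[OF herm psd k \<open>f k k = 0\<close>] that show ?thesis by simp
    qed (use zero that in auto)
    from step.IH[OF herm psd this] obtain g where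
      "\<forall>i<p. \<forall>j<p. f i j = (\<Sum>t<p. cnj (g t i) * g t j)" "\<forall>t<Suc k. \<forall>i. g t i = 0" by blast
    then show ?thesis by (intro exI[of _ g]) simp
  next
    case False
    define a where "a = Re (f k k)"
    have fa: "f k k = of_real a"
      using arg_cong[OF hermitian_funD[OF herm k k], of Im] by (simp add: a_def complex_eq_iff)
    have "0 \<le> qform p f (\<lambda>i. 0 + (if i = k then 1 else 0))" by (rule psd)
    also have "\<dots> = f k k"
      by (subst qform_shift[OF herm k]) (simp add: qform_def)
    finally have a0: "a > 0" using False fa by (simp add: less_eq_complex_def)
    define f' where "f' = (\<lambda>i j. f i j - f i k * f k j / f k k)"
    have h': "hermitian_fun p f'"
      unfolding hermitian_fun_def
    proof (intro allI impI)
      fix i j assume ij: "i < p" "j < p"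
      note e = hermitian_funD[OF herm ij] hermitian_funD[OF herm k ij(2)] hermitian_funD[OF herm ij(1) k]
      show "f' j i = cnj (f' i j)"
        unfolding f'_def e fa by simp
    qed
    have p': "0 \<le> qform p f' v" for v
      unfolding f'_def by (rule psd_schur_complement[OF herm psd k False])
    have z': "f' i j = 0" if "i < Suc k" "j < p" for i j
      using zero that k False by (cases "i = k") (auto simp: f'_def)
    from step.IH[OF h' p' z'] obtain g where
      g: "\<And>i j. i < p \<Longrightarrow> j < p \<Longrightarrow> f' i j = (\<Sum>t<p. cnj (g t i) * g t j)"
      and g0: "\<And>t i. t < Suc k \<Longrightarrow> g t i = 0" by blast
    \<comment> \<open>The pivot row, scaled by the root of the pivot, contributes exactly the
      rank-one term subtracted in \<open>f'\<close>.\<close>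
    define G where "G = (\<lambda>t j. if t = k then f k j / of_real (sqrt a) else g t j)"
    have sq: "of_real (sqrt a) * of_real (sqrt a) = (of_real a :: complex)"
      using a0 by (simp flip: of_real_mult)
    have "f i j = (\<Sum>t<p. cnj (G t i) * G t j)" if ij: "i < p" "j < p" for i j
    proof -
      have "(\<Sum>t<p. cnj (G t i) * G t j) =
          (\<Sum>t<p. cnj (g t i) * g t j + (if t = k then cnj (f k i) * f k j / of_real a else 0))"
        by (intro sum.cong refl) (auto simp: G_def g0 sq)
      also have "\<dots> = f' i j + cnj (f k i) * f k j / of_real a"
        using k by (simp add: sum.distrib g ij sum.delta)
      also have "\<dots> = f i j"
        using hermitian_funD[OF herm k ij(1)] by (simp add: f'_def fa)
      finally show ?thesis by simp
    qed
    moreover have "\<forall>t<k. \<forall>i. G t i = 0"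
      using g0 by (simp add: G_def)
    ultimately show ?thesis by blast
  qed
qed

section \<open>Adjoints, Gram matrices and the passage from functions to matrices\<close>

lemma dim_mat_adjoint [simp]: "dim_row (mat_adjoint A) = dim_col A" "dim_col (mat_adjoint A) = dim_row A"
  by (auto simp: mat_adjoint_def)

lemma mat_adjoint_carrier [simp, intro]: "A \<in> carrier_mat n m \<Longrightarrow> mat_adjoint A \<in> carrier_mat m n"
  by auto

lemma index_mat_adjoint [simp]:
  "i < dim_col A \<Longrightarrow> j < dim_row A \<Longrightarrow> mat_adjoint A $$ (i, j) = cnj (A $$ (j, i))"
  for A :: "complex mat"
  by (simp add: mat_adjoint_def mat_of_rows_index)

lemma index_gram:
  fixes A :: "complex mat"
  assumes "A \<in> carrier_mat n m" "i < m" "j < m"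
  shows "(mat_adjoint A * A) $$ (i, j) = (\<Sum>t<n. cnj (A $$ (t, i)) * A $$ (t, j))"
  using assms by (auto simp: scalar_prod_def atLeast0LessThan intro!: sum.cong)

lemma mat_adjoint_mult:
  fixes A B :: "complex mat"
  assumes "A \<in> carrier_mat n m" "B \<in> carrier_mat m k"
  shows "mat_adjoint (A * B) = mat_adjoint B * mat_adjoint A"
  using assms by (intro eq_matI) (auto simp: scalar_prod_def intro!: sum.cong)

lemma quadratic_form_eq_qform:
  assumes "H \<in> carrier_mat p p" "v \<in> carrier_vec p"
  shows "(H *\<^sub>v v) \<bullet>c v = qform p (\<lambda>i j. H $$ (i, j)) (\<lambda>i. v $ i)"
  using assms
  by (auto simp: qform_def scalar_prod_def sum_distrib_right atLeast0LessThan intro!: sum.cong)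

lemma pos_semidef_obtain_gram:
  assumes psd: "pos_semidef_mat H" and H: "H \<in> carrier_mat p p"
  obtains G where "G \<in> carrier_mat p p" "mat_adjoint G * G = H"
proof -
  define f where "f = (\<lambda>i j. H $$ (i, j))"
  have herm: "hermitian_fun p f"
    unfolding hermitian_fun_def
  proof (intro allI impI)
    fix i j assume "i < p" "j < p"
    then have "mat_adjoint H $$ (j, i) = cnj (H $$ (i, j))" using H by simp
    then show "f j i = cnj (f i j)"
      using psd by (simp add: pos_semidef_mat_def hermitian_mat_def f_def)
  qed
  have "0 \<le> qform p f v" for v
  proof -
    have "0 \<le> (H *\<^sub>v vec p v) \<bullet>c vec p v"
      using psd H unfolding pos_semidef_mat_def by (metis carrier_matD(2) vec_carrier)
    also have "\<dots> = qform p f v"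
      by (subst quadratic_form_eq_qform[OF H]) (auto simp: qform_def f_def)
    finally show ?thesis .
  qed
  from psd_gram_aux[of 0 p f, OF _ herm this] obtain g where
    g: "\<And>i j. i < p \<Longrightarrow> j < p \<Longrightarrow> f i j = (\<Sum>t<p. cnj (g t i) * g t j)" by auto
  show ?thesis
  proof (rule that)
    let ?G = "mat p p (\<lambda>(t, i). g t i)"
    show "?G \<in> carrier_mat p p" by simp
    show "mat_adjoint ?G * ?G = H"
    proof (rule eq_matI)
      fix i j assume "i < dim_row H" "j < dim_col H"
      with H have "i < p" "j < p" by auto
      then show "(mat_adjoint ?G * ?G) $$ (i, j) = H $$ (i, j)"
        by (subst index_gram[of _ p p]) (use g[of i j] in \<open>auto simp: f_def\<close>)
    qed (use H in auto)
  qed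
qed

lemma pos_def_imp_pos_semidef: "pos_def_mat H \<Longrightarrow> pos_semidef_mat H"
proof -
  assume pd: "pos_def_mat H"
  have "0 \<le> (H *\<^sub>v v) \<bullet>c v" if v: "v \<in> carrier_vec (dim_col H)" for v
  proof (cases "v = 0\<^sub>v (dim_col H)")
    case True
    then show ?thesis by (auto simp: scalar_prod_def)
  next
    case False
    with pd v show ?thesis unfolding pos_def_mat_def by force
  qed
  with pd show ?thesis by (simp add: pos_def_mat_def pos_semidef_mat_def)
qed

text \<open>A kernel vector of \<open>G\<close> would annihilate the form. This turns strict
  decrease between cycles into invertible blocks.\<close>

lemma pos_def_gram_det_nonzero:
  assumes pd: "pos_def_mat (mat_adjoint G * G)" and G: "G \<in> carrier_mat p p"
  shows "det G \<noteq> 0"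
proof
  assume "det G = 0"
  then obtain v where v: "v \<in> carrier_vec p" "v \<noteq> 0\<^sub>v p" "G *\<^sub>v v = 0\<^sub>v p"
    using det_0_iff_vec_prod_zero[OF G] by auto
  have "mat_adjoint G * G *\<^sub>v v = mat_adjoint G *\<^sub>v (G *\<^sub>v v)"
    using G v by (intro assoc_mult_mat_vec[of _ p p _ p]) auto
  also have "\<dots> = 0\<^sub>v p" using G v by (intro eq_vecI) (auto simp: scalar_prod_def)
  finally have "(mat_adjoint G * G *\<^sub>v v) \<bullet>c v = 0" using v by (auto simp: scalar_prod_def)
  moreover have "0 < (mat_adjoint G * G *\<^sub>v v) \<bullet>c v"
    using pd G v unfolding pos_def_mat_def by auto
  ultimately show False by simp
qed

lemma det_nonzero_obtain_inverse:
  fixes A :: "'a :: field mat"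
  assumes A: "A \<in> carrier_mat n n" and "det A \<noteq> 0"
  obtains B where "B \<in> carrier_mat n n" "B * A = 1\<^sub>m n" "A * B = 1\<^sub>m n"
  using det_non_zero_imp_unit[OF A assms(2), unfolded Units_def, of "()"]
  by (auto simp: ring_mat_def)

section \<open>Block norm, rank and Frobenius norm\<close>

lemma S_plusD:
  assumes "R \<in> S_plus p"
  shows "R \<in> carrier_mat p p" "\<And>i j. j < i \<Longrightarrow> i < p \<Longrightarrow> R $$ (i, j) = 0" "\<And>i. i < p \<Longrightarrow> 0 < R $$ (i, i)"
  using assms unfolding S_plus_def upper_triangular_def by auto

lemma S_plus_det_nonzero: "R \<in> S_plus p \<Longrightarrow> det R \<noteq> 0"
  using upper_triangular_imp_det_eq_0_iff[of R p]
  by (force simp: S_plus_def diag_mat_def)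

text \<open>Triangularity cuts the sum off at row \<open>i\<close>, so the Gram matrix can be read
  row by row from the top.\<close>

lemma gram_triangular_index:
  assumes R: "R \<in> S_plus p" and ij: "i < p" "j < p"
  shows "(mat_adjoint R * R) $$ (i, j) =
    (\<Sum>t<i. cnj (R $$ (t, i)) * R $$ (t, j)) + cnj (R $$ (i, i)) * R $$ (i, j)"
proof -
  have "(mat_adjoint R * R) $$ (i, j) = (\<Sum>t<p. cnj (R $$ (t, i)) * R $$ (t, j))"
    using S_plusD(1)[OF R] ij by (rule index_gram)
  also have "\<dots> = (\<Sum>t<Suc i. cnj (R $$ (t, i)) * R $$ (t, j))"
    using ij S_plusD(2)[OF R] by (intro sum.mono_neutral_right) auto
  finally show ?thesis by simp
qed

text \<open>Uniqueness of the Cholesky factor: once earlier rows agree, the diagonal equation fixes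
  the positive pivot, and division by it fixes the rest of the row.\<close>

lemma S_plus_gram_unique:
  assumes R: "R \<in> S_plus p" and S: "S \<in> S_plus p"
    and eq: "mat_adjoint R * R = mat_adjoint S * S"
  shows "R = S"
proof -
  have "R $$ (i, j) = S $$ (i, j)" if "i < p" "j < p" for i j
    using that
  proof (induction i arbitrary: j rule: less_induct)
    case (less i)
    have row: "cnj (R $$ (i, i)) * R $$ (i, j) = cnj (S $$ (i, i)) * S $$ (i, j)" if j: "j < p" for j
    proof -
      have "(\<Sum>t<i. cnj (R $$ (t, i)) * R $$ (t, j)) = (\<Sum>t<i. cnj (S $$ (t, i)) * S $$ (t, j))"
        using less j by (intro sum.cong) auto
      then show ?thesis
        using gram_triangular_index[OF R less.prems(1) j] gram_triangular_index[OF S less.prems(1) j] eq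
        by simp
    qed
    obtain r s where rs: "R $$ (i, i) = of_real r" "S $$ (i, i) = of_real s" "r > 0" "s > 0"
      using S_plusD(3)[OF R less.prems(1)] S_plusD(3)[OF S less.prems(1)]
      by (metis less_complex_def complex_eq_iff zero_complex.sel Re_complex_of_real Im_complex_of_real)
    have "r * r = s * s"
      using row[OF less.prems(1)] by (simp add: rs flip: of_real_mult)
    then have "r = s" using rs(3,4) by (simp add: power2_eq_square[symmetric] power2_eq_iff)
    then show ?case using row[OF less.prems(2)] rs by simp
  qed
  then show ?thesis using S_plusD(1)[OF R] S_plusD(1)[OF S] by (intro eq_matI) auto
qed

lemma gram_mult:
  fixes Z T :: "complex mat"
  assumes Z: "Z \<in> carrier_mat n p" and T: "T \<in> carrier_mat p q"
  shows "mat_adjoint (Z * T) * (Z * T) = mat_adjoint T * (mat_adjoint Z * Z) * T"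
proof -
  have c: "mat_adjoint Z \<in> carrier_mat p n" "mat_adjoint T \<in> carrier_mat q p" "Z * T \<in> carrier_mat n q"
    "mat_adjoint Z * Z \<in> carrier_mat p p"
    using Z T by auto
  show ?thesis
    unfolding mat_adjoint_mult[OF Z T] assoc_mult_mat[OF c(2,1,3)] assoc_mult_mat[OF c(2,4) T]
    by (simp add: assoc_mult_mat[OF c(1) Z T])
qed

text \<open>With \<open>T\<close> inverse to \<open>R\<close>, the columns of \<open>Z * T\<close>
  are orthonormal, which gives existence; a competing factor has the same Gram matrix and so equals
  \<open>R\<close>.\<close>

lemma block_norm_eqI:
  assumes Z: "Z \<in> carrier_mat n p" and R: "R \<in> S_plus p"
    and eq: "mat_adjoint Z * Z = mat_adjoint R * R"
  shows "block_norm Z = R"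
proof -
  note Rc = S_plusD(1)[OF R]
  obtain T where T: "T \<in> carrier_mat p p" "T * R = 1\<^sub>m p" "R * T = 1\<^sub>m p"
    using det_nonzero_obtain_inverse[OF Rc S_plus_det_nonzero[OF R]] .
  have "mat_adjoint (Z * T) * (Z * T) = mat_adjoint T * (mat_adjoint Z * Z) * T"
    by (rule gram_mult[OF Z T(1)])
  also have "\<dots> = mat_adjoint (R * T) * (R * T)"
    unfolding gram_mult[OF Rc T(1)] eq ..
  also have "\<dots> = 1\<^sub>m p" unfolding T(3)
    by (intro eq_matI) (auto simp: scalar_prod_def if_distrib[of cnj] sum.delta cong: if_cong intro!: sum.cong)
  finally have Q: "mat_adjoint (Z * T) * (Z * T) = 1\<^sub>m p" .
  have ZTR: "Z = Z * T * R"
    using Z T Rc by (simp add: assoc_mult_mat[of _ n p _ p _ p])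
  show ?thesis
    unfolding block_norm_def
  proof (rule the_equality)
    show "R \<in> S_plus (dim_col Z) \<and> (\<exists>Q \<in> carrier_mat (dim_row Z) (dim_col Z).
        mat_adjoint Q * Q = 1\<^sub>m (dim_col Z) \<and> Z = Q * R)"
      using Z T(1) R Q ZTR by (auto intro!: bexI[of _ "Z * T"])
  next
    fix S
    assume "S \<in> S_plus (dim_col Z) \<and> (\<exists>Q \<in> carrier_mat (dim_row Z) (dim_col Z).
        mat_adjoint Q * Q = 1\<^sub>m (dim_col Z) \<and> Z = Q * S)"
    then obtain Q where S: "S \<in> S_plus p" and Q: "Q \<in> carrier_mat n p" "mat_adjoint Q * Q = 1\<^sub>m p" "Z = Q * S"
      using Z by auto
    note Sc = S_plusD(1)[OF S]
    have "mat_adjoint Z * Z = mat_adjoint S * (mat_adjoint Q * Q) * S"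
      unfolding Q(3) by (rule gram_mult[OF Q(1) Sc])
    also have "\<dots> = mat_adjoint S * S" using Sc by (simp add: Q(2) right_mult_one_mat[of _ p p])
    finally show "S = R" using eq by (intro S_plus_gram_unique[OF S R]) simp
  qed
qed

lemma full_column_rankI:
  assumes Z: "Z \<in> carrier_mat n p"
    and inj: "\<And>v. v \<in> carrier_vec p \<Longrightarrow> Z *\<^sub>v v = 0\<^sub>v n \<Longrightarrow> v = 0\<^sub>v p"
  shows "full_column_rank Z"
proof -
  interpret vec_space "TYPE(complex)" n .
  \<comment> \<open>Independence concerns the set of columns, so repetitions are excluded first: two
    equal columns put a difference of unit vectors into the kernel.\<close>
  have "distinct (cols Z)"
    unfolding distinct_conv_nth
  proof (intro allI impI notI)
    fix i j assume "i < length (cols Z)" "j < length (cols Z)" and ij: "i \<noteq> j" "cols Z ! i = cols Z ! j"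
    then have i: "i < p" and j: "j < p" and "col Z i = col Z j" using Z by auto
    then have eq: "Z $$ (r, i) = Z $$ (r, j)" if "r < n" for r
      using that Z by (metis carrier_matD index_col)
    define v :: "complex vec" where "v = vec p (\<lambda>t. (if t = i then 1 else 0) - (if t = j then 1 else 0))"
    have "Z *\<^sub>v v = 0\<^sub>v n"
    proof (rule eq_vecI)
      fix r assume "r < dim_vec (0\<^sub>v n :: complex vec)"
      then have r: "r < n" by simp
      then have "(Z *\<^sub>v v) $ r = (\<Sum>t<p. (if t = i then Z $$ (r, t) else 0) - (if t = j then Z $$ (r, t) else 0))"
        using Z by (auto simp: v_def scalar_prod_def atLeast0LessThan intro!: sum.cong)
      also have "\<dots> = 0" using i j eq[OF r] by (simp add: sum_subtractf)
      finally show "(Z *\<^sub>v v) $ r = 0\<^sub>v n $ r" using r by simp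
    qed (use Z in auto)
    then have "v = 0\<^sub>v p" by (intro inj) (simp_all add: v_def)
    moreover have "v $ i = 1" using i ij by (simp add: v_def)
    ultimately show False using i by simp
  qed
  moreover from this have "lin_indpt (set (cols Z))"
    using lin_depE[OF Z] inj by metis
  ultimately have "rank Z = p" by (intro lin_indpt_full_rank[OF Z])
  then show ?thesis using Z by (simp add: full_column_rank_def)
qed

text \<open>A kernel vector of \<open>Z\<close> lies in the kernel of the Gram matrix, which is a
  product of two invertible triangular matrices.\<close>

lemma full_column_rank_gramI:
  assumes Z: "Z \<in> carrier_mat n p" and R: "R \<in> S_plus p"
    and eq: "mat_adjoint Z * Z = mat_adjoint R * R"
  shows "full_column_rank Z"
proof (rule full_column_rankI[OF Z])
  fix v :: "complex vec" assume v: "v \<in> carrier_vec p" "Z *\<^sub>v v = 0\<^sub>v n"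
  note Rc = S_plusD(1)[OF R]
  have "(mat_adjoint R * R) *\<^sub>v v = mat_adjoint Z *\<^sub>v (Z *\<^sub>v v)"
    using Z v(1) unfolding eq[symmetric] by (intro assoc_mult_mat_vec[of _ p n _ p]) auto
  also have "\<dots> = 0\<^sub>v p" using Z v by (intro eq_vecI) (auto simp: scalar_prod_def)
  finally have z: "(mat_adjoint R * R) *\<^sub>v v = 0\<^sub>v p" .
  have "mat_adjoint R * R \<in> carrier_mat p p" using Rc by auto
  moreover have "det (mat_adjoint R * R) \<noteq> 0"
  proof -
    have "det (mat_adjoint R) \<noteq> 0"
    proof -
      obtain T where T: "T \<in> carrier_mat p p" "R * T = 1\<^sub>m p"
        using det_nonzero_obtain_inverse[OF Rc S_plus_det_nonzero[OF R]] by metis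
      have "mat_adjoint T * mat_adjoint R = mat_adjoint (1\<^sub>m p)"
        unfolding T(2)[symmetric] by (rule mat_adjoint_mult[OF Rc T(1), symmetric])
      also have "\<dots> = 1\<^sub>m p" by (intro eq_matI) auto
      finally have "det (mat_adjoint T) * det (mat_adjoint R) = 1"
        using det_mult[of "mat_adjoint T" p "mat_adjoint R"] T(1) Rc by simp
      then show ?thesis by auto
    qed
    then show ?thesis using Rc S_plus_det_nonzero[OF R] det_mult[of "mat_adjoint R" p R] by auto
  qed
  ultimately show "v = 0\<^sub>v p" using det_0_iff_vec_prod_zero v(1) z by blast
qed

text \<open>\<open>H\<close> arises from \<open>D\<close> by zeroing entries. Minimality of a
  residual and its uniqueness thus both reduce to an entrywise comparison.\<close>

lemma frobenius_norm_agree_on_support: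
  assumes H: "H \<in> carrier_mat n p" and D: "D \<in> carrier_mat n p"
    and agree: "\<And>r c. r < n \<Longrightarrow> c < p \<Longrightarrow> H $$ (r, c) = 0 \<or> D $$ (r, c) = H $$ (r, c)"
  shows "frobenius_norm H \<le> frobenius_norm D"
    and "frobenius_norm D \<le> frobenius_norm H \<Longrightarrow> D = H"
proof -
  define d where "d = (\<lambda>r c. (cmod (D $$ (r, c)))\<^sup>2 - (cmod (H $$ (r, c)))\<^sup>2)"
  have d: "0 \<le> d r c" if "r < n" "c < p" for r c
    using agree[OF that] by (auto simp: d_def)
  have dsum: "(\<Sum>r<dim_row D. \<Sum>c<dim_col D. (cmod (D $$ (r, c)))\<^sup>2)
     - (\<Sum>r<dim_row H. \<Sum>c<dim_col H. (cmod (H $$ (r, c)))\<^sup>2) = (\<Sum>r<n. \<Sum>c<p. d r c)"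
    using H D by (simp add: d_def sum_subtractf)
  have nn: "0 \<le> (\<Sum>r<n. \<Sum>c<p. d r c)" using d by (intro sum_nonneg) auto
  show "frobenius_norm H \<le> frobenius_norm D"
    unfolding frobenius_norm_def using nn dsum by (intro real_sqrt_le_mono) linarith
  assume "frobenius_norm D \<le> frobenius_norm H"
  then have "(\<Sum>r<n. \<Sum>c<p. d r c) = 0"
    unfolding frobenius_norm_def using nn dsum by simp
  then have row: "(\<Sum>c<p. d r c) = 0" if "r < n" for r
    by (subst (asm) sum_nonneg_eq_0_iff) (use d that in \<open>auto intro!: sum_nonneg\<close>)
  have d0: "d r c = 0" if "r < n" "c < p" for r c
    using row[OF that(1)] by (subst (asm) sum_nonneg_eq_0_iff) (use d that in auto)
  have "D $$ (r, c) = H $$ (r, c)" if "r < n" "c < p" for r c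
    using agree[OF that] d0[OF that] by (auto simp: d_def)
  then show "D = H" using H D by (intro eq_matI) auto
qed

section \<open>A matrix shifting blocks and its residuals\<close>

lemma pow_mat_Suc_left:
  fixes A :: "'a :: semiring_1 mat"
  assumes A: "A \<in> carrier_mat n n"
  shows "A ^\<^sub>m Suc k = A * A ^\<^sub>m k"
proof (induction k)
  case 0
  then show ?case using A by simp
next
  case (Suc k)
  have "A ^\<^sub>m Suc (Suc k) = A * A ^\<^sub>m k * A" using Suc by simp
  then show ?case using A by (simp add: assoc_mult_mat[of _ n n _ n _ n])
qed

lemma index_mult_mat_sum:
  assumes "A \<in> carrier_mat n m" "X \<in> carrier_mat m k" "r < n" "c < k"
  shows "(A * X) $$ (r, c) = (\<Sum>t<m. A $$ (r, t) * X $$ (t, c))"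
  using assms by (auto simp: scalar_prod_def atLeast0LessThan intro!: sum.cong)

lemma sum_div_mod:
  fixes g :: "nat \<Rightarrow> nat \<Rightarrow> 'a :: comm_monoid_add"
  shows "(\<Sum>r<N * p. g (r div p) (r mod p)) = (\<Sum>b<N. \<Sum>s<p. g b s)"
proof -
  have "(\<Sum>r<N * p. g (r div p) (r mod p)) = (\<Sum>b<N. \<Sum>r = b * p..<b * p + p. g (r div p) (r mod p))"
    by (rule sum.nat_group[symmetric])
  also have "\<dots> = (\<Sum>b<N. \<Sum>s<p. g b s)"
  proof (rule sum.cong[OF refl])
    fix b
    have "(\<Sum>r = b * p..<b * p + p. g (r div p) (r mod p)) = (\<Sum>s = 0..<p. g ((s + b * p) div p) ((s + b * p) mod p))"
      using sum.shift_bounds_nat_ivl[of "\<lambda>r. g (r div p) (r mod p)" 0 "b * p" p] by (simp add: add.commute)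
    also have "\<dots> = (\<Sum>s<p. g b s)"
      by (intro sum.cong) auto
    finally show "(\<Sum>r = b * p..<b * p + p. g (r div p) (r mod p)) = (\<Sum>s<p. g b s)" .
  qed
  finally show ?thesis .
qed

section \<open>Block columns and matrices with prescribed action on them\<close>

definition block_column :: "nat \<Rightarrow> nat \<Rightarrow> (nat \<Rightarrow> complex mat) \<Rightarrow> complex mat" where
  "block_column p N X = mat (N * p) p (\<lambda>(r, c). X (r div p) $$ (r mod p, c))"

text \<open>For \<open>b \<ge> N\<close> no row lies in block \<open>b\<close> and the matrix is
  zero; the end of the last cycle relies on this.\<close>

definition unit_block :: "nat \<Rightarrow> nat \<Rightarrow> nat \<Rightarrow> complex mat \<Rightarrow> complex mat" where
  "unit_block p N b S = block_column p N (\<lambda>b'. if b' = b then S else 0\<^sub>m p p)"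

lemma block_column_carrier [simp]: "block_column p N X \<in> carrier_mat (N * p) p"
  by (simp add: block_column_def)

lemma dim_block_column [simp]:
  "dim_row (block_column p N X) = N * p" "dim_col (block_column p N X) = p"
  by (simp_all add: block_column_def)

lemma unit_block_carrier [simp]: "unit_block p N b S \<in> carrier_mat (N * p) p"
  by (simp add: unit_block_def)

lemma dim_unit_block [simp]:
  "dim_row (unit_block p N b S) = N * p" "dim_col (unit_block p N b S) = p"
  by (simp_all add: unit_block_def)

lemma index_block_column [simp]:
  "r < N * p \<Longrightarrow> c < p \<Longrightarrow> block_column p N X $$ (r, c) = X (r div p) $$ (r mod p, c)"
  by (simp add: block_column_def)

lemma index_unit_block [simp]:
  "r < N * p \<Longrightarrow> c < p \<Longrightarrow>
    unit_block p N b S $$ (r, c) = (if r div p = b then S $$ (r mod p, c) else 0)"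
  by (cases "p = 0") (auto simp: unit_block_def)

lemma unit_block_mult:
  assumes "S \<in> carrier_mat p p"
  shows "unit_block p N b (1\<^sub>m p) * S = unit_block p N b S"
proof (rule eq_matI)
  fix r c assume rc': "r < dim_row (unit_block p N b S)" "c < dim_col (unit_block p N b S)"
  then have rc: "r < N * p" "c < p" and "r mod p < p" by auto
  then have "(unit_block p N b (1\<^sub>m p) * S) $$ (r, c) =
      (\<Sum>t<p. if t = r mod p then (if r div p = b then S $$ (t, c) else 0) else 0)"
    using assms by (auto simp: scalar_prod_def atLeast0LessThan if_distrib[of "\<lambda>x. x * _"] cong: if_cong)
  also have "\<dots> = unit_block p N b S $$ (r, c)"
    using rc \<open>r mod p < p\<close> by simp
  finally show "(unit_block p N b (1\<^sub>m p) * S) $$ (r, c) = unit_block p N b S $$ (r, c)" .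
qed (use assms in auto)

text \<open>The block unit vectors together form the identity, so their images are simply the column
  blocks of the matrix and can be chosen freely.\<close>

lemma exists_mat_with_block_images:
  assumes C: "\<And>b. b < N \<Longrightarrow> C b \<in> carrier_mat (N * p) p"
  shows "\<exists>A \<in> carrier_mat (N * p) (N * p). \<forall>b<N. A * unit_block p N b (1\<^sub>m p) = C b"
proof (intro bexI allI impI)
  let ?A = "mat (N * p) (N * p) (\<lambda>(r, c). C (c div p) $$ (r, c mod p))"
  show "?A \<in> carrier_mat (N * p) (N * p)" by simp
  fix b assume b: "b < N"
  show "?A * unit_block p N b (1\<^sub>m p) = C b"
  proof (rule eq_matI)
    fix r c assume "r < dim_row (C b)" "c < dim_col (C b)"
    with C[OF b] have rc: "r < N * p" "c < p" by auto
    have *: "i < N * p \<Longrightarrow> i div p = b \<and> i mod p = c \<longleftrightarrow> i = b * p + c" for i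
      using rc(2) by (metis add.commute div_mult_mod_eq div_mult_self3 div_less mod_mult_self3 mod_less
          add.left_neutral less_nat_zero_code mult.commute)
    have "(b * p + c) div p = b" "(b * p + c) mod p = c"
      using rc(2) by simp_all
    have bc: "b * p + c < N * p"
      using b rc(2) by (metis add.commute add_less_cancel_right mult_Suc order_less_le_trans
          mult_le_mono1 Suc_leI)
    have "(?A * unit_block p N b (1\<^sub>m p)) $$ (r, c) =
        (\<Sum>i<N * p. if i div p = b \<and> i mod p = c then C (i div p) $$ (r, i mod p) else 0)"
      using rc by (auto simp: scalar_prod_def atLeast0LessThan intro!: sum.cong)
    also have "\<dots> = (\<Sum>i<N * p. if i = b * p + c then C b $$ (r, c) else 0)"
      using * \<open>(b * p + c) div p = b\<close> \<open>(b * p + c) mod p = c\<close> by (intro sum.cong) auto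
    also have "\<dots> = C b $$ (r, c)" using bc by simp
    finally show "(?A * unit_block p N b (1\<^sub>m p)) $$ (r, c) = C b $$ (r, c)" .
  qed (use C[OF b] in auto)
qed

lemma gram_block_column:
  assumes X: "\<And>b. b < N \<Longrightarrow> X b \<in> carrier_mat p p" and ij: "i < p" "j < p"
  shows "(mat_adjoint (block_column p N X) * block_column p N X) $$ (i, j) =
    (\<Sum>b<N. (mat_adjoint (X b) * X b) $$ (i, j))"
proof -
  have "(mat_adjoint (block_column p N X) * block_column p N X) $$ (i, j) =
     (\<Sum>r<N * p. cnj (X (r div p) $$ (r mod p, i)) * X (r div p) $$ (r mod p, j))"
    using ij by (subst index_gram[of _ "N * p" p]) auto
  also have "\<dots> = (\<Sum>b<N. \<Sum>s<p. cnj (X b $$ (s, i)) * X b $$ (s, j))"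
    by (rule sum_div_mod)
  also have "\<dots> = (\<Sum>b<N. (mat_adjoint (X b) * X b) $$ (i, j))"
    using X ij by (intro sum.cong refl index_gram[symmetric]) auto
  finally show ?thesis .
qed

text \<open>Blocks are numbered across all cycles, each starting at a multiple of \<open>M\<close>;
  hence \<open>M dvd Suc b\<close> marks the last block of a cycle.\<close>

locale residual_chain =
  fixes p N M :: nat and G :: "nat \<Rightarrow> complex mat"
  assumes M: "0 < M" and M_dvd_N: "M dvd N"
    and G: "\<And>b. G b \<in> carrier_mat p p"
    and G_det: "\<And>b. b < N \<Longrightarrow> M dvd Suc b \<Longrightarrow> det (G b) \<noteq> 0"
begin

abbreviation E :: "nat \<Rightarrow> complex mat" where
  "E b \<equiv> unit_block p N b (1\<^sub>m p)"

definition H :: "nat \<Rightarrow> complex mat" where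
  "H m = block_column p N (\<lambda>b. if m \<le> b then G b else 0\<^sub>m p p)"

text \<open>
  \<open>Y a m\<close> is what \<open>A\<close> makes of the blocks \<open>a, \<dots>, m - 1\<close> of \<open>H a\<close> when it shifts each of them
  down by one.
\<close>

definition Y :: "nat \<Rightarrow> nat \<Rightarrow> complex mat" where
  "Y a m = block_column p N (\<lambda>b. if a < b \<and> b \<le> m then G (b - 1) else 0\<^sub>m p p)"

lemma carriers [simp]: "H m \<in> carrier_mat (N * p) p" "Y a m \<in> carrier_mat (N * p) p"
  by (simp_all add: H_def Y_def)

lemma dims [simp]: "dim_row (H m) = N * p" "dim_col (H m) = p" "dim_row (Y a m) = N * p" "dim_col (Y a m) = p"
  by (simp_all add: H_def Y_def)

lemma index_H [simp]:
  "r < N * p \<Longrightarrow> c < p \<Longrightarrow> H m $$ (r, c) = (if m \<le> r div p then G (r div p) $$ (r mod p, c) else 0)"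
  by (cases "p = 0") (auto simp: H_def)

lemma index_Y [simp]:
  "r < N * p \<Longrightarrow> c < p \<Longrightarrow>
    Y a m $$ (r, c) = (if a < r div p \<and> r div p \<le> m then G (r div p - 1) $$ (r mod p, c) else 0)"
  by (cases "p = 0") (auto simp: Y_def)

lemma div_less_N: "r < N * p \<Longrightarrow> r div p < N"
  by (simp add: less_mult_imp_div_less)

lemma div_neq_N: "r < N * p \<Longrightarrow> \<not> N \<le> r div p" "r < N * p \<Longrightarrow> r div p \<noteq> N"
  using div_less_N by fastforce+

lemma H_Suc: "H m = unit_block p N m (G m) + H (Suc m)"
  by (intro eq_matI) (auto simp: Suc_le_eq order.order_iff_strict)

text \<open>The index at which the cycle containing \<open>m\<close> starts.\<close>

definition base :: "nat \<Rightarrow> nat" where "base m = m - m mod M"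

lemma base_Suc: "base (Suc m) = (if M dvd Suc m then Suc m else base m)"
  by (auto simp: base_def mod_Suc dvd_eq_mod_eq_0)

lemma base_eq: "M dvd m \<Longrightarrow> base m = m"
  by (simp add: base_def)

text \<open>
  \<open>C b\<close> is the prescribed image \<open>A * E b\<close>. At the end of a cycle it is obtained by solving
  \<open>A * H (base b) = E (base b)\<close> for it; note that \<open>E N = 0\<close>, which covers the last cycle.
\<close>

definition C :: "nat \<Rightarrow> complex mat" where
  "C b = (if M dvd Suc b
     then (E (base b) - Y (base b) b - E (Suc b)) * (SOME T. T \<in> carrier_mat p p \<and> T * G b = 1\<^sub>m p)
     else E (Suc b))"

text \<open>\<open>C b * G b\<close> will be the image under \<open>A\<close> of block
  \<open>b\<close> of \<open>H m\<close>; at the end of a cycle the left inverse inside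
  \<open>C b\<close> cancels.\<close>

lemma C_mult:
  assumes b: "b < N"
  shows "C b \<in> carrier_mat (N * p) p"
    and "C b * G b = (if M dvd Suc b then E (base b) - Y (base b) b - E (Suc b)
      else unit_block p N (Suc b) (G b))"
proof -
  define T where "T = (SOME T. T \<in> carrier_mat p p \<and> T * G b = 1\<^sub>m p)"
  have T: "T \<in> carrier_mat p p \<and> T * G b = 1\<^sub>m p" if "M dvd Suc b"
    unfolding T_def by (rule someI_ex) (use det_nonzero_obtain_inverse[OF G G_det[OF b that]] in blast)
  have D: "E (base b) - Y (base b) b - E (Suc b) \<in> carrier_mat (N * p) p"
    by (intro minus_carrier_mat) simp
  show "C b \<in> carrier_mat (N * p) p"
    using T D by (auto simp: C_def T_def[symmetric])
  show "C b * G b = (if M dvd Suc b then E (base b) - Y (base b) b - E (Suc b)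
      else unit_block p N (Suc b) (G b))"
  proof (cases "M dvd Suc b")
    case True
    then have "C b * G b = (E (base b) - Y (base b) b - E (Suc b)) * (T * G b)"
      unfolding C_def T_def[symmetric] using T[OF True] D by (simp add: assoc_mult_mat[OF D _ G])
    then show ?thesis using True T[OF True] D by simp
  next
    case False
    then show ?thesis by (simp add: C_def unit_block_mult[OF G])
  qed
qed

text \<open>This extends \<open>A * H a = E a\<close> from cycle starts to all \<open>m\<close>, so
  that blocks can be peeled off one at a time: \<open>Y\<close> accounts for the blocks from
  \<open>base m\<close> to \<open>m - 1\<close> that \<open>H m\<close> lacks.\<close>

lemma image_H:
  assumes A: "A \<in> carrier_mat (N * p) (N * p)" and AE: "\<forall>b<N. A * E b = C b"
    and "m \<le> N"
  shows "A * H m = E (base m) - Y (base m) m"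
  using \<open>m \<le> N\<close>
proof (induction m rule: inc_induct)
  case base
  \<comment> \<open>Both sides vanish at \<open>N\<close>, as no row has block index
    \<open>N\<close> or more.\<close>
  have "H N = 0\<^sub>m (N * p) p"
    by (intro eq_matI) (auto simp: div_neq_N)
  then have "A * H N = 0\<^sub>m (N * p) p" using A by simp
  also have "\<dots> = E N - Y N N"
    by (intro eq_matI) (auto simp: div_neq_N)
  finally show ?case using base_eq[OF M_dvd_N] by simp
next
  case (step m)
  have m: "m < N" using step.hyps by simp
  have "A * unit_block p N m (G m) = A * E m * G m"
    using assoc_mult_mat[OF A unit_block_carrier G] by (simp add: unit_block_mult[OF G])
  also have "\<dots> = C m * G m" by (simp add: AE[rule_format, OF m])
  finally have "A * H m = C m * G m + (E (base (Suc m)) - Y (base (Suc m)) (Suc m))"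
    using A by (subst H_Suc) (simp add: mult_add_distrib_mat[of _ "N * p" "N * p" _ p] step.IH)
  also have "\<dots> = E (base m) - Y (base m) m"
  proof (cases "M dvd Suc m")
    case True
    \<comment> \<open>At the cycle boundary \<open>Y (Suc m) (Suc m)\<close> is zero, and
      \<open>E (Suc m)\<close> cancels against the one in \<open>C m * G m\<close>.\<close>
    then show ?thesis unfolding C_mult(2)[OF m] base_Suc by (intro eq_matI) auto
  next
    case False
    have "base m \<le> m" by (simp add: base_def)
    with False show ?thesis unfolding C_mult(2)[OF m] base_Suc
      by (intro eq_matI) (auto simp: le_Suc_eq)
  qed
  finally show ?case .
qed

text \<open>The first application of \<open>A\<close> turns \<open>H a\<close> into
  \<open>E a\<close>; each further one shifts by a block, as long as the last block of the cycle has
  not been reached.\<close>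

lemma pow_image_H:
  assumes A: "A \<in> carrier_mat (N * p) (N * p)" and AE: "\<forall>b<N. A * E b = C b"
    and a: "M dvd a" "a < N" and "i < M"
  shows "A ^\<^sub>m Suc i * H a = E (a + i)"
  using \<open>i < M\<close>
proof (induction i)
  case 0
  have "Y a a = 0\<^sub>m (N * p) p" by (intro eq_matI) auto
  then have "A * H a = E a - 0\<^sub>m (N * p) p"
    using image_H[OF A AE, of a] a base_eq[of a] by simp
  also have "\<dots> = E a" by (intro eq_matI) auto
  finally show ?case using A by simp
next
  case (Suc i)
  have "\<not> M dvd Suc (a + i)"
    using a(1) Suc.prems dvd_add_right_iff[of M a "Suc i"] by (auto dest: dvd_imp_le)
  \<comment> \<open>Both \<open>a\<close> and \<open>N\<close> are multiples of \<open>M\<close>, so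
    a whole cycle fits between them.\<close>
  moreover have "a + i < N"
  proof -
    obtain k k' where "a = M * k" "N = M * k'" using a(1) M_dvd_N by (auto elim!: dvdE)
    with a(2) have "a + M \<le> N"
      using mult_le_mono2[of "Suc k" k' M] by simp
    then show ?thesis using Suc.prems by simp
  qed
  moreover have "A ^\<^sub>m Suc (Suc i) * H a = A * (A ^\<^sub>m Suc i * H a)"
    unfolding pow_mat_Suc_left[OF A, of "Suc i"]
    by (rule assoc_mult_mat[of _ "N * p" "N * p" _ "N * p" _ p]) (use A in auto)
  ultimately show ?case using Suc by (simp add: AE C_def)
qed

text \<open>Coefficient \<open>S i\<close> lands in block \<open>a + i\<close>, so the image of the
  Krylov space consists of all block columns supported on the blocks \<open>a\<close> to
  \<open>a + j - 1\<close>.\<close>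

lemma image_block_krylov:
  assumes A: "A \<in> carrier_mat (N * p) (N * p)" and AE: "\<forall>b<N. A * E b = C b"
    and a: "M dvd a" "a < N" and j: "j \<le> M" and S: "\<And>i. i < j \<Longrightarrow> S i \<in> carrier_mat p p"
  shows "A * mat (N * p) p (\<lambda>(r, c). \<Sum>i<j. (A ^\<^sub>m i * H a * S i) $$ (r, c)) =
    block_column p N (\<lambda>b. if a \<le> b \<and> b < a + j then S (b - a) else 0\<^sub>m p p)"
proof (rule eq_matI)
  fix r c assume "r < dim_row (block_column p N (\<lambda>b. if a \<le> b \<and> b < a + j then S (b - a) else 0\<^sub>m p p))"
    "c < dim_col (block_column p N (\<lambda>b. if a \<le> b \<and> b < a + j then S (b - a) else 0\<^sub>m p p))"
  then have rc: "r < N * p" "c < p" and "r mod p < p" by auto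
  have AS: "A * (A ^\<^sub>m i * H a * S i) = unit_block p N (a + i) (S i)" if i: "i < j" for i
  proof -
    have c: "A ^\<^sub>m i \<in> carrier_mat (N * p) (N * p)" "A ^\<^sub>m i * H a \<in> carrier_mat (N * p) p"
      using A by (auto intro: mult_carrier_mat)
    have "A * (A ^\<^sub>m i * H a * S i) = A ^\<^sub>m Suc i * H a * S i"
      unfolding pow_mat_Suc_left[OF A] assoc_mult_mat[OF A c(1) carriers(1)]
      by (rule assoc_mult_mat[OF A c(2) S[OF i], symmetric])
    also have "\<dots> = unit_block p N (a + i) (S i)"
      using pow_image_H[OF A AE a, of i] i j by (simp add: unit_block_mult[OF S[OF i]])
    finally show ?thesis .
  qed
  have dims: "dim_row (A ^\<^sub>m i * H a * S i) = N * p" "i < j \<Longrightarrow> dim_col (A ^\<^sub>m i * H a * S i) = p" for i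
    using A S[of i] by auto
  have "(A * mat (N * p) p (\<lambda>(r, c). \<Sum>i<j. (A ^\<^sub>m i * H a * S i) $$ (r, c))) $$ (r, c) =
      (\<Sum>t<N * p. A $$ (r, t) * (\<Sum>i<j. (A ^\<^sub>m i * H a * S i) $$ (t, c)))"
    using rc A by (auto simp: scalar_prod_def atLeast0LessThan intro!: sum.cong)
  also have "\<dots> = (\<Sum>i<j. \<Sum>t<N * p. A $$ (r, t) * (A ^\<^sub>m i * H a * S i) $$ (t, c))"
    unfolding sum_distrib_left by (rule sum.swap)
  also have "\<dots> = (\<Sum>i<j. (A * (A ^\<^sub>m i * H a * S i)) $$ (r, c))"
    by (intro sum.cong refl index_mult_mat_sum[symmetric]) (use rc A dims in auto)
  also have "\<dots> = (\<Sum>i<j. if r div p = a + i then S i $$ (r mod p, c) else 0)"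
    using rc by (intro sum.cong refl) (simp add: AS)
  \<comment> \<open>The inner guard \<open>a \<le> r div p\<close> protects against truncated
    subtraction.\<close>
  also have "\<dots> = (\<Sum>i<j. if i = r div p - a then (if a \<le> r div p then S (r div p - a) $$ (r mod p, c) else 0) else 0)"
    by (intro sum.cong refl) auto
  also have "\<dots> = block_column p N (\<lambda>b. if a \<le> b \<and> b < a + j then S (b - a) else 0\<^sub>m p p) $$ (r, c)"
    using rc \<open>r mod p < p\<close> by auto
  finally show "(A * mat (N * p) p (\<lambda>(r, c). \<Sum>i<j. (A ^\<^sub>m i * H a * S i) $$ (r, c))) $$ (r, c) =
      block_column p N (\<lambda>b. if a \<le> b \<and> b < a + j then S (b - a) else 0\<^sub>m p p) $$ (r, c)" .
qed (use A in auto)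

text \<open>The attainable residuals are \<open>H a\<close> with the blocks \<open>a\<close> to
  \<open>a + j - 1\<close> replaced arbitrarily; the minimum puts zeros there. The second claim
  concerns every minimizer, since only the residual has to be unique.\<close>

lemma gmres_cycle:
  assumes A: "A \<in> carrier_mat (N * p) (N * p)" and AE: "\<forall>b<N. A * E b = C b"
    and a: "M dvd a" "a < N" and j: "j \<le> M"
    and B: "B \<in> carrier_mat (N * p) p" and X0: "X0 \<in> carrier_mat (N * p) p"
    and res: "residual A B X0 = H a"
  shows "\<exists>X. gmres_iterate A B X0 j X"
    and "gmres_iterate A B X0 j X \<Longrightarrow> X \<in> carrier_mat (N * p) p \<and> residual A B X = H (a + j)"
proof -
  define K where "K = (\<lambda>S. mat (N * p) p (\<lambda>(r, c). \<Sum>i<j. (A ^\<^sub>m i * H a * S i) $$ (r, c)))"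
  have Kc: "K S \<in> carrier_mat (N * p) p" for S by (simp add: K_def)
  have krylov: "block_krylov j A (residual A B X0) = {K S | S. \<forall>i<j. S i \<in> carrier_mat p p}"
    unfolding block_krylov_def K_def res by simp
  have iter: "gmres_iterate A B X0 j X \<longleftrightarrow>
      (\<exists>S. (\<forall>i<j. S i \<in> carrier_mat p p) \<and> X = X0 + K S) \<and>
      (\<forall>S. (\<forall>i<j. S i \<in> carrier_mat p p) \<longrightarrow>
        frobenius_norm (residual A B X) \<le> frobenius_norm (residual A B (X0 + K S)))" for X
    unfolding gmres_iterate_def krylov Let_def by blast
  have r: "residual A B (X0 + K S) = H a -
      block_column p N (\<lambda>b. if a \<le> b \<and> b < a + j then S (b - a) else 0\<^sub>m p p)"
    if S: "\<forall>i<j. S i \<in> carrier_mat p p" for S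
  proof -
    have "residual A B (X0 + K S) = residual A B X0 - A * K S"
      unfolding residual_def mult_add_distrib_mat[OF A X0 Kc]
      using A B X0 Kc[of S] by (intro eq_matI) auto
    then show ?thesis
      unfolding res using image_block_krylov[OF A AE a j, of S] S by (simp add: K_def)
  qed
  \<comment> \<open>These coefficients cancel the first \<open>j\<close> blocks of
    \<open>H a\<close>.\<close>
  define S0 where "S0 = (\<lambda>i. G (a + i))"
  have S0: "\<forall>i<j. S0 i \<in> carrier_mat p p" using G by (simp add: S0_def)
  have r0: "residual A B (X0 + K S0) = H (a + j)"
    unfolding r[OF S0] by (intro eq_matI) (auto simp: S0_def)
  have agree: "H (a + j) $$ (i, c) = 0 \<or> residual A B (X0 + K S) $$ (i, c) = H (a + j) $$ (i, c)"
    if "\<forall>i<j. S i \<in> carrier_mat p p" "i < N * p" "c < p" for S i c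
    using that by (cases "a + j \<le> i div p") (auto simp: r)
  have rc: "residual A B (X0 + K S) \<in> carrier_mat (N * p) p" if "\<forall>i<j. S i \<in> carrier_mat p p" for S
    unfolding r[OF that] by (intro minus_carrier_mat) simp
  show "\<exists>X. gmres_iterate A B X0 j X"
    using iter[of "X0 + K S0"] S0 frobenius_norm_agree_on_support(1)[OF carriers(1) rc agree]
    unfolding r0 by blast
  assume "gmres_iterate A B X0 j X"
  then obtain S where S: "\<forall>i<j. S i \<in> carrier_mat p p" "X = X0 + K S"
    and "frobenius_norm (residual A B X) \<le> frobenius_norm (residual A B (X0 + K S0))"
    using iter S0 by blast
  then have "residual A B X = H (a + j)"
    using frobenius_norm_agree_on_support(2)[OF carriers(1) rc agree] unfolding r0 by blast
  then show "X \<in> carrier_mat (N * p) p \<and> residual A B X = H (a + j)"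
    using S(2) X0 Kc by simp
qed

text \<open>The Krylov space for \<open>j = 0\<close> contains only the empty sum.\<close>

lemma gmres_iterate_0:
  assumes X0: "X0 \<in> carrier_mat (N * p) p" and res: "residual A B X0 = H a"
    and X: "gmres_iterate A B X0 0 X"
  shows "X = X0"
proof -
  obtain Z where "Z \<in> block_krylov 0 A (residual A B X0)" "X = X0 + Z"
    using X unfolding gmres_iterate_def Let_def by blast
  then show ?thesis using X0 unfolding block_krylov_def res by (intro eq_matI) auto
qed

lemma restarted_gmres_residuals:
  assumes A: "A \<in> carrier_mat (N * p) (N * p)" and AE: "\<forall>b<N. A * E b = C b"
    and N: "N = l * M" and l: "0 < l"
  shows "\<exists>X. restarted_gmres A (H 0) M l X"
    and "restarted_gmres A (H 0) M l X \<Longrightarrow> k \<in> {1..l} \<Longrightarrow> j < M \<Longrightarrow>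
      residual A (H 0) (X k j) = H ((k - 1) * M + j)"
proof -
  let ?step = "\<lambda>x j. SOME X. gmres_iterate A (H 0) x j X"
  \<comment> \<open>Here \<open>k\<close> counts completed cycles from 0, whereas the cycles of a
    run are numbered from 1.\<close>
  let ?inv = "\<lambda>k x. x \<in> carrier_mat (N * p) p \<and> residual A (H 0) x = H (k * M)"
  have init: "?inv 0 (0\<^sub>m (N * p) p)"
    using A by (auto simp: residual_def intro!: eq_matI)
  have kM: "k * M < N" if "k < l" for k
    using that M N by simp
  note ex = gmres_cycle(1)[OF A AE _ kM _ carriers(1)]
  note cyc = gmres_cycle(2)[OF A AE _ kM _ carriers(1)]
  define x where "x = rec_nat (0\<^sub>m (N * p) p) (\<lambda>_ x. ?step x M)"
  have x_simps: "x 0 = 0\<^sub>m (N * p) p" "x (Suc k) = ?step (x k) M" for k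
    by (simp_all add: x_def)
  have step: "gmres_iterate A (H 0) y j (?step y j)" if "?inv k y" "k < l" "j \<le> M" for k y j
    by (rule someI_ex) (use ex[of k j y] that in auto)
  have x: "?inv k (x k)" if "k \<le> l" for k
    using that
  proof (induction k)
    case 0
    then show ?case using init by (simp add: x_simps)
  next
    case (Suc k)
    then have k: "k < l" and IH: "?inv k (x k)" by auto
    from cyc[OF _ k _ _ _ step[OF IH k order_refl]] IH show ?case
      by (simp add: x_simps add.commute)
  qed
  \<comment> \<open>Only the starting points \<open>x\<close> need recursion. The choice at
    \<open>j = M\<close> is literally the next starting point, and at \<open>j = 0\<close> it is
    forced to be the current one.\<close>
  let ?X = "\<lambda>k j. ?step (x (k - 1)) j"
  have X0: "?X (Suc k) 0 = x k" if "k < l" for k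
    using gmres_iterate_0[OF _ _ step[OF x that]] x[of k] that by simp
  have "restarted_gmres A (H 0) M l ?X"
    unfolding restarted_gmres_def
  proof (intro conjI ballI allI impI)
    show "?X 1 0 = 0\<^sub>m (dim_row (H 0)) (dim_col (H 0))"
      using X0[OF l] x_simps by simp
  next
    fix k j assume "k \<in> {1..l}" "j \<le> M"
    then obtain k' where "k = Suc k'" "k' < l" by (cases k) auto
    then show "gmres_iterate A (H 0) (?X k 0) j (?X k j)"
      using step[OF x[of k'], of j] X0[of k'] \<open>j \<le> M\<close> by simp
  next
    fix k assume "k \<in> {1..<l}"
    then obtain k' where "k = Suc k'" "Suc k' < l" by (cases k) auto
    then show "?X (Suc k) 0 = ?X k M"
      using X0[of "Suc k'"] x_simps by simp
  qed
  then show "\<exists>X. restarted_gmres A (H 0) M l X" by blast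
  assume gm: "restarted_gmres A (H 0) M l X" and k: "k \<in> {1..l}" and j: "j < M"
  have gi: "gmres_iterate A (H 0) (X (Suc i) 0) j' (X (Suc i) j')" if "i < l" "j' \<le> M" for i j'
    using gm that unfolding restarted_gmres_def by auto
  \<comment> \<open>The same invariant, now for an arbitrary run instead of the constructed
    one.\<close>
  have inv: "?inv i (X (Suc i) 0)" if "i < l" for i
    using that
  proof (induction i)
    case 0
    then show ?case using gm init by (simp add: restarted_gmres_def)
  next
    case (Suc i)
    then have i: "i < l" and IH: "?inv i (X (Suc i) 0)" by auto
    have "X (Suc (Suc i)) 0 = X (Suc i) M"
      using gm Suc.prems unfolding restarted_gmres_def by simp
    with cyc[OF _ i _ _ _ gi[OF i order_refl]] IH show ?case
      by (simp add: add.commute)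
  qed
  obtain i where i: "k = Suc i" "i < l" using k by (cases k) auto
  show "residual A (H 0) (X k j) = H ((k - 1) * M + j)"
    using cyc[OF _ i(2) _ _ _ gi[OF i(2), of j]] inv[OF i(2)] j i(1) by simp
qed

lemma gram_H:
  assumes ij: "i < p" "j < p"
  shows "(mat_adjoint (H m) * H m) $$ (i, j) = (\<Sum>b\<in>{m..<N}. (mat_adjoint (G b) * G b) $$ (i, j))"
proof -
  have "(mat_adjoint (H m) * H m) $$ (i, j) =
      (\<Sum>b<N. if m \<le> b then (mat_adjoint (G b) * G b) $$ (i, j) else 0)"
    unfolding H_def by (subst gram_block_column) (use G ij in \<open>auto intro!: sum.cong\<close>)
  also have "\<dots> = (\<Sum>b\<in>{m..<N}. (mat_adjoint (G b) * G b) $$ (i, j))"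
    by (intro sum.mono_neutral_cong_right) auto
  finally show ?thesis .
qed

end

text \<open>Existence of a run is claimed separately so that the statement about all runs is not
  vacuous, and full column rank so that \<open>block_norm\<close> is meaningful.\<close>

theorem theorem5p9:
  fixes p M l N n :: nat and F :: "nat \<Rightarrow> nat \<Rightarrow> complex mat"
  assumes "p \<ge> 1" and "M \<ge> 1" and "l \<ge> 1" and "N = l * M" and "n = N * p"
    and "\<forall>k \<in> {1..l}. \<forall>j < M. F k j \<in> S_plus p"
    and "\<forall>k \<in> {1..l}. \<forall>j. Suc j < M \<longrightarrow> F k (Suc j) \<le>\<^sub>S F k j"
    and "\<forall>k \<in> {1..<l}. F (Suc k) 0 <\<^sub>S F k (M - 1)"
    and "0\<^sub>m p p <\<^sub>S F l (M - 1)"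
  shows "\<exists>A \<in> carrier_mat n n. \<exists>B \<in> carrier_mat n p.
    (\<exists>X. restarted_gmres A B M l X) \<and>
    (\<forall>X. restarted_gmres A B M l X \<longrightarrow>
      (\<forall>k \<in> {1..l}. \<forall>j < M.
        full_column_rank (residual A B (X k j)) \<and>
        block_norm (residual A B (X k j)) = F k j))"
proof -
  \<comment> \<open>The value zero from \<open>N\<close> on makes the telescoping sum of the
    \<open>D b\<close> end in zero.\<close>
  define \<Phi> where "\<Phi> = (\<lambda>b. if b < N then F (b div M + 1) (b mod M) else 0\<^sub>m p p)"
  define D where "D = (\<lambda>b. mat_adjoint (\<Phi> b) * \<Phi> b - mat_adjoint (\<Phi> (Suc b)) * \<Phi> (Suc b))"
  have M: "0 < M" and l: "0 < l" and N: "N = l * M" and n: "n = N * p"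
    using assms by auto
  have \<Phi>: "\<Phi> b \<in> S_plus p" if "b < N" for b
  proof -
    have "b div M < l" using that N by (simp add: less_mult_imp_div_less)
    then show ?thesis using assms(6) that M by (auto simp: \<Phi>_def)
  qed
  have \<Phi>c: "\<Phi> b \<in> carrier_mat p p" for b
    using S_plusD(1)[OF \<Phi>] by (cases "b < N") (auto simp: \<Phi>_def)
  have Dc: "D b \<in> carrier_mat p p" for b
    using \<Phi>c[of b] \<Phi>c[of "Suc b"] unfolding D_def by (intro minus_carrier_mat) auto
  have pd: "pos_def_mat (D b)" if b: "b < N" "M dvd Suc b" for b
  proof -
    obtain k where k: "Suc b = k * M" using b(2) by (metis dvd_def mult.commute)
    have k0: "0 < k" using k by (cases k) auto
    have "b = (M - 1) + (k - 1) * M" using k k0 M by (cases k) auto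
    then have "b div M = k - 1" "b mod M = M - 1"
      using M div_mult_self1[of M "M - 1" "k - 1"] mod_mult_self1[of "M - 1" "k - 1" M] by auto
    then have \<Phi>b: "\<Phi> b = F k (M - 1)" using b(1) k0 by (simp add: \<Phi>_def)
    have kl: "k \<le> l" using b(1) M unfolding N by (metis Suc_leI k mult_le_cancel2)
    show ?thesis
    proof (cases "k = l")
      \<comment> \<open>After the last cycle, positive definiteness of the final prescribed norm
        takes the place of strict decrease.\<close>
      case True
      then have "\<Phi> (Suc b) = 0\<^sub>m p p" using k N by (simp add: \<Phi>_def)
      then show ?thesis using assms(9) True by (simp add: tri_less_def D_def \<Phi>b)
    next
      case False
      then have kl: "k < l" using kl by simp
      then have "\<Phi> (Suc b) = F (Suc k) 0" using k N M by (simp add: \<Phi>_def)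
      then show ?thesis using assms(8) kl k0 by (simp add: tri_less_def D_def \<Phi>b)
    qed
  qed
  have psd: "pos_semidef_mat (D b)" if b: "b < N" for b
  proof (cases "M dvd Suc b")
    case True
    then show ?thesis using pd b pos_def_imp_pos_semidef by blast
  next
    case False
    then have m: "Suc b mod M = Suc (b mod M)" "Suc b div M = b div M"
      using M by (auto simp: mod_Suc div_Suc dvd_eq_mod_eq_0)
    have "Suc b \<noteq> N" using False N by auto
    then have "Suc b < N" using b by simp
    moreover have "Suc (b mod M) < M" using m(1) M by (metis mod_less_divisor)
    moreover have "b div M < l" using b N by (simp add: less_mult_imp_div_less)
    ultimately show ?thesis
      using assms(7) b unfolding D_def \<Phi>_def tri_le_def by (simp add: m)
  qed
  \<comment> \<open>For \<open>b \<ge> N\<close> the zero matrix is the witness, because the locale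
    asks for the carrier at every index.\<close>
  have "\<exists>G. G \<in> carrier_mat p p \<and> (b < N \<longrightarrow> mat_adjoint G * G = D b)" for b
    using pos_semidef_obtain_gram[OF psd Dc, of b] zero_carrier_mat[of p p] by blast
  then obtain G where Gc: "\<And>b. G b \<in> carrier_mat p p" and gram_G: "\<And>b. b < N \<Longrightarrow> mat_adjoint (G b) * G b = D b"
    by metis
  interpret residual_chain p N M G
  proof
    show "det (G b) \<noteq> 0" if "b < N" "M dvd Suc b" for b
      using pos_def_gram_det_nonzero[OF _ Gc] pd[OF that] gram_G[OF that(1)] by metis
  qed (use M N Gc in auto)
  obtain A where A: "A \<in> carrier_mat (N * p) (N * p)" and AE: "\<forall>b<N. A * E b = C b"
    using exists_mat_with_block_images[of N C p] C_mult(1) by blast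
  have gram: "mat_adjoint (H m) * H m = mat_adjoint (\<Phi> m) * \<Phi> m" if m: "m \<le> N" for m
  proof (rule eq_matI)
    fix i j assume "i < dim_row (mat_adjoint (\<Phi> m) * \<Phi> m)" "j < dim_col (mat_adjoint (\<Phi> m) * \<Phi> m)"
    then have ij: "i < p" "j < p" using \<Phi>c[of m] by auto
    define \<phi> where "\<phi> = (\<lambda>b. (mat_adjoint (\<Phi> b) * \<Phi> b) $$ (i, j))"
    have "(mat_adjoint (H m) * H m) $$ (i, j) = (\<Sum>b\<in>{m..<N}. D b $$ (i, j))"
      unfolding gram_H[OF ij] by (intro sum.cong) (auto simp: gram_G)
    also have "\<dots> = (\<Sum>b\<in>{m..<N}. \<phi> b - \<phi> (Suc b))"
      using ij unfolding D_def \<phi>_def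
      by (intro sum.cong refl index_minus_mat) (simp_all add: carrier_matD[OF \<Phi>c])
    also have "\<dots> = - (\<Sum>b\<in>{m..<N}. \<phi> (Suc b) - \<phi> b)"
      by (simp add: sum_negf[symmetric])
    also have "\<dots> = \<phi> m - \<phi> N"
      by (subst sum_Suc_diff'[OF m]) simp
    also have "\<phi> N = 0" using ij by (simp add: \<phi>_def \<Phi>_def scalar_prod_def)
    finally show "(mat_adjoint (H m) * H m) $$ (i, j) = (mat_adjoint (\<Phi> m) * \<Phi> m) $$ (i, j)"
      by (simp add: \<phi>_def)
  qed (use \<Phi>c[of m] in auto)
  have cycle: "full_column_rank (residual A (H 0) (X k j)) \<and> block_norm (residual A (H 0) (X k j)) = F k j"
    if X: "restarted_gmres A (H 0) M l X" and k: "k \<in> {1..l}" and j: "j < M" for X k j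
  proof -
    let ?m = "(k - 1) * M + j"
    have "?m < (k - 1) * M + M" using j by simp
    also have "\<dots> = k * M" using k by (cases k) auto
    also have "\<dots> \<le> N" using k N by simp
    finally have m: "?m < N" .
    have "\<Phi> ?m = F k j" using m k j by (simp add: \<Phi>_def)
    then show ?thesis
      using restarted_gmres_residuals(2)[OF A AE N l X k j] gram[of ?m] \<Phi>[OF m] m
        full_column_rank_gramI[OF carriers(1)] block_norm_eqI[OF carriers(1)] by simp
  qed
  show ?thesis
    unfolding n using A cycle restarted_gmres_residuals(1)[OF A AE N l]
    by (intro bexI[of _ A] bexI[of _ "H 0"]) auto
qed

end
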